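(* Let $i,j,k$ be even positive integers. Then the eggbeater graph $E_{i,j,k}$ has exactly one edge-Kempe equivalence class of $3$-edge-colorings.
   Context: Graphs are finite, simple and undirected. A $3$-edge-coloring of a cubic (i.e. $3$-regular) graph is a partition of its edge set into $3$ (unlabeled) color classes such that no two adjacent edges are in the same class. Given a $3$-edge-coloring of a cubic graph, the union of any two of its color classes is a disjoint union of cycles of even length, whose edges alternate between the two colors; an edge-Kempe switch interchanges the two colors along one such cycle, yielding another $3$-edge-coloring. Two $3$-edge-colorings of the same graph are edge-Kempe equivalent if one can be obtained from the other by a (possibly empty) finite sequence of edge-Kempe switches; the equivalence classes of this relation are the edge-Kempe equivalence classes. For $n\ge 1$, the ladder graph $L_n$ is $P_2\times P_n$ (Cartesian product): it has vertices $x_1,\dots,x_n,y_1,\dots,y_n$, rungs $\{x_t,y_t\}$ for $1\le t\le n$, and edges $\{x_t,x_{t+1}\}$, $\{y_t,y_{t+1}\}$ for $1\le t\le n-1$. The ladder graph with pendants $LP_n$ is obtained from $L_n$ by adding four new vertices $v_a,v_b,v_c,v_d$ and the four pendant edges $e_a=\{v_a,x_1\}$, $e_b=\{v_b,y_1\}$, $e_c=\{v_c,x_n\}$, $e_d=\{v_d,y_n\}$. The eggbeater graph $E_{i,j,k}$ is obtained from disjoint copies of $LP_i$, $LP_j$ and $LP_k$ by merging the three copies of $v_a$ into one vertex, the three copies of $v_b$ into one vertex, the three copies of $v_c$ into one vertex, and the three copies of $v_d$ into one vertex. It is a cubic graph of order $2(i+j+k)+4$. *)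

theory Defs
  imports Main "HOL-Library.Disjoint_Sets"
begin

text \<open>A finite simple graph is a pair of a vertex set and a set of two-element vertex sets.\<close>

type_synonym 'v graph = "'v set \<times> 'v set set"

abbreviation verts :: "'v graph \<Rightarrow> 'v set" where "verts \<equiv> fst"
abbreviation edges :: "'v graph \<Rightarrow> 'v set set" where "edges \<equiv> snd"

text \<open>
  The classes of a coloring are unlabeled, so a coloring is a set of three edge sets. The
  predicate \<^const>\<open>partition_on\<close> requires the classes to be nonempty; in a nonempty cubic graph
  this is automatic, as every vertex meets all three classes.
\<close>

definition three_edge_colorings :: "'v graph \<Rightarrow> 'v set set set set" where
  "three_edge_colorings G =
     {C. partition_on (edges G) C \<and> card C = 3 \<and>
         (\<forall>A \<in> C. \<forall>e \<in> A. \<forall>f \<in> A. e \<noteq> f \<longrightarrow> e \<inter> f = {})}"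

definition cycle_edges :: "'v list \<Rightarrow> 'v set set" where
  "cycle_edges vs = {{vs ! t, vs ! (Suc t mod length vs)} | t. t < length vs}"

definition is_cycle :: "'v set set \<Rightarrow> bool" where
  "is_cycle K \<longleftrightarrow> (\<exists>vs. 3 \<le> length vs \<and> distinct vs \<and> K = cycle_edges vs)"

text \<open>
  In a cubic graph the union of two color classes is 2-regular, so every cycle contained
  in \<open>A \<union> B\<close> is one of the cycles of which \<open>A \<union> B\<close> is the disjoint union.
\<close>

definition kempe_switch :: "'v graph \<Rightarrow> ('v set set set \<times> 'v set set set) set" where
  "kempe_switch G =
     {(C, D). C \<in> three_edge_colorings G \<and>
        (\<exists>A \<in> C. \<exists>B \<in> C. \<exists>K. A \<noteq> B \<and> is_cycle K \<and> K \<subseteq> A \<union> B \<and>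
           D = (C - {A, B}) \<union> {(A - K) \<union> (B \<inter> K), (B - K) \<union> (A \<inter> K)})}"

definition kempe_equivalence :: "'v graph \<Rightarrow> ('v set set set \<times> 'v set set set) set" where
  "kempe_equivalence G =
     {(C, D). C \<in> three_edge_colorings G \<and> D \<in> three_edge_colorings G \<and>
        (C, D) \<in> (kempe_switch G)\<^sup>*}"

definition kempe_classes :: "'v graph \<Rightarrow> 'v set set set set set" where
  "kempe_classes G = three_edge_colorings G // kempe_equivalence G"

datatype ladder_vertex = X nat | Y nat

datatype pendant = Va | Vb | Vc | Vd

definition ladder :: "nat \<Rightarrow> ladder_vertex graph" where
  "ladder n =
     (X ` {1..n} \<union> Y ` {1..n},
      {{X t, Y t} | t. 1 \<le> t \<and> t \<le> n} \<union>
      {{X t, X (t + 1)} | t. 1 \<le> t \<and> t + 1 \<le> n} \<union>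
      {{Y t, Y (t + 1)} | t. 1 \<le> t \<and> t + 1 \<le> n})"

definition ladder_pendants :: "nat \<Rightarrow> (ladder_vertex + pendant) graph" where
  "ladder_pendants n =
     (Inl ` verts (ladder n) \<union> Inr ` {Va, Vb, Vc, Vd},
      (image Inl) ` edges (ladder n) \<union>
      {{Inr Va, Inl (X 1)}, {Inr Vb, Inl (Y 1)}, {Inr Vc, Inl (X n)}, {Inr Vd, Inl (Y n)}})"

text \<open>
  Tagging only the ladder vertices with the number \<open>c\<close> of their copy makes the ladders
  disjoint and identifies the three copies of each pendant vertex.
\<close>

definition merge_copy :: "nat \<Rightarrow> ladder_vertex + pendant \<Rightarrow> (nat \<times> ladder_vertex) + pendant" where
  "merge_copy c = map_sum (Pair c) id"

definition eggbeater :: "nat \<Rightarrow> nat \<Rightarrow> nat \<Rightarrow> ((nat \<times> ladder_vertex) + pendant) graph" where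
  "eggbeater i j k =
     (\<Union>(c, n) \<in> {(1, i), (2, j), (3, k)}. merge_copy c ` verts (ladder_pendants n),
      \<Union>(c, n) \<in> {(1, i), (2, j), (3, k)}. (image (merge_copy c)) ` edges (ladder_pendants n))"

end

(*
  Two 3-edge-colorings with a common class A are Kempe equivalent: the edges on which they differ
  all lie in the two remaining classes and have degree at least 2 at each vertex they meet, so they
  contain a cycle of alternating colors, and switching it makes the colorings agree on more edges.

  It remains to connect any two colorings by a chain in which neighbours share a class. In a ladder
  with pendants of even length, either the two pendants at one end have different colors and
  everything is forced, or both rails carry the same walk in the complete graph on the three colors.
  If some ladder is of the forced kind, keeping one class fixed turns a 3-cycle of end colors into a
  transposition and a transposition into the identity, so that all ladders become walks. Walks of
  the same length with the same ends are connected by changes that preserve one color, and explicit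
  zigzag walks permute the colors at one end of the three ladders arbitrarily.
*)
theory Submission
  imports Defs "HOL-Combinatorics.Permutations"
begin

section \<open>Colorings of a cubic graph that share a class\<close>

text \<open>In a longest path, a second edge at the first vertex must lead back into the path, as it
  would prolong it otherwise; this edge closes an initial segment to a cycle.\<close>

lemma ex_cycle_if_min_degree_2:
  assumes "finite S" "S \<noteq> {}" and two: "\<And>e. e \<in> S \<Longrightarrow> card e = 2"
    and deg: "\<And>e v. \<lbrakk>e \<in> S; v \<in> e\<rbrakk> \<Longrightarrow> \<exists>e'\<in>S. v \<in> e' \<and> e' \<noteq> e"
  shows "\<exists>K\<subseteq>S. is_cycle K"
proof -
  define path where "path vs \<longleftrightarrow> distinct vs \<and> 2 \<le> length vs \<and>
    (\<forall>t. Suc t < length vs \<longrightarrow> {vs ! t, vs ! Suc t} \<in> S)" for vs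
  have fin: "finite (\<Union>S)"
    using assms(1) two by (metis card.infinite finite_Union zero_neq_numeral)
  obtain e where "e \<in> S" using assms(2) by blast
  then obtain x y where xy: "e = {x, y}" "x \<noteq> y" using two by (meson card_2_iff)
  have base: "path [x, y]"
    using xy \<open>e \<in> S\<close> by (simp add: path_def less_Suc_eq)
  have sub: "set vs \<subseteq> \<Union>S" if "path vs" for vs
  proof
    fix v assume "v \<in> set vs"
    then obtain t where t: "t < length vs" "v = vs ! t" by (metis in_set_conv_nth)
    show "v \<in> \<Union>S"
    proof (cases "Suc t < length vs")
      case True
      then have "{vs ! t, vs ! Suc t} \<in> S" using that by (simp add: path_def)
      then show ?thesis using t by blast
    next
      case False
      with t that obtain u where "t = Suc u" by (cases t) (auto simp: path_def)
      then have "{vs ! u, vs ! t} \<in> S" using that t by (simp add: path_def)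
      then show ?thesis using t by blast
    qed
  qed
  have bound: "\<forall>vs. path vs \<longrightarrow> length vs \<le> card (\<Union>S)"
  proof (intro allI impI)
    fix vs assume p: "path vs"
    then have "length vs = card (set vs)" by (simp add: path_def distinct_card)
    also have "\<dots> \<le> card (\<Union>S)" using sub[OF p] fin by (rule card_mono[rotated])
    finally show "length vs \<le> card (\<Union>S)" .
  qed
  obtain vs where vs: "path vs" and max: "\<And>ws. path ws \<Longrightarrow> length ws \<le> length vs"
    using ex_has_greatest_nat[of path "[x, y]" length "Suc (card (\<Union>S))"] base bound
    by (auto simp: less_Suc_eq_le)
  have len: "2 \<le> length vs" and dis: "distinct vs" using vs by (auto simp: path_def)
  have "{vs ! 0, vs ! 1} \<in> S" using vs by (auto simp: path_def)
  with deg[of _ "vs ! 0"] obtain e' where e': "e' \<in> S" "vs ! 0 \<in> e'" "e' \<noteq> {vs ! 0, vs ! 1}"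
    by blast
  obtain w where w: "e' = {w, vs ! 0}" "w \<noteq> vs ! 0" "w \<noteq> vs ! 1"
    using two[OF e'(1)] e'(2,3) by (auto simp: card_2_iff insert_commute)
  have "w \<in> set vs"
  proof (rule ccontr)
    assume "w \<notin> set vs"
    moreover have "{(w # vs) ! t, (w # vs) ! Suc t} \<in> S" if "Suc t < length (w # vs)" for t
      using that w(1) e'(1) vs by (cases t) (auto simp: path_def)
    ultimately have "path (w # vs)" using vs by (auto simp: path_def)
    from max[OF this] show False by simp
  qed
  then obtain m where m: "m < length vs" "w = vs ! m" by (metis in_set_conv_nth)
  \<comment> \<open>\<open>w\<close> is neither of the first two vertices of the path, so the cycle
    to be closed has at least three vertices.\<close>
  have m2: "2 \<le> m" using w(2,3) m(2) by (metis One_nat_def less_2_cases not_less)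
  let ?c = "take (Suc m) vs"
  have lc: "length ?c = Suc m" using m by simp
  have "is_cycle (cycle_edges ?c)"
    unfolding is_cycle_def using lc m2 dis by (intro exI[of _ ?c]) auto
  moreover have "cycle_edges ?c \<subseteq> S"
  proof
    fix f assume "f \<in> cycle_edges ?c"
    then obtain t where t: "t < Suc m" "f = {?c ! t, ?c ! (Suc t mod Suc m)}"
      unfolding cycle_edges_def lc by blast
    show "f \<in> S"
    proof (cases "t = m")
      case True
      then show ?thesis using t e'(1) w(1) m by simp
    next
      case False
      then show ?thesis using t m vs by (simp add: path_def)
    qed
  qed
  ultimately show ?thesis by blast
qed

text \<open>The second edge at \<open>v\<close> continues the cycle away from \<open>e\<close>,
  backwards from its first end or forwards from the other. Length at least 3 keeps the far end
  outside \<open>e\<close>.\<close>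

lemma cycle_degree_2:
  assumes "is_cycle K" "e \<in> K" "v \<in> e"
  shows "\<exists>e'\<in>K. v \<in> e' \<and> e' \<noteq> e"
proof -
  obtain vs where vs: "3 \<le> length vs" "distinct vs" "K = cycle_edges vs"
    using assms(1) by (auto simp: is_cycle_def)
  let ?n = "length vs"
  obtain t where t: "t < ?n" "e = {vs ! t, vs ! (Suc t mod ?n)}"
    using assms(2) vs(3) by (auto simp: cycle_edges_def)
  have mem: "{vs ! u, vs ! (Suc u mod ?n)} \<in> K" if "u < ?n" for u
    using that vs(3) by (auto simp: cycle_edges_def)
  have ne: "vs ! a \<noteq> vs ! b" if "a < ?n" "b < ?n" "a \<noteq> b" for a b
    using that vs(2) by (simp add: nth_eq_iff_index_eq)
  let ?s = "Suc t mod ?n"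
  have s: "?s = (if Suc t = ?n then 0 else Suc t)" using t(1) by (simp add: mod_Suc)
  show ?thesis
  proof (cases "v = vs ! t")
    case True
    define u where "u = (if t = 0 then ?n - 1 else t - 1)"
    have u: "u < ?n" "Suc u mod ?n = t" "u \<noteq> t" "u \<noteq> ?s"
      using t(1) vs(1) s by (auto simp: u_def)
    have "?s < ?n" using vs(1) by (intro mod_less_divisor) linarith
    then have "vs ! u \<notin> e"
      using ne[OF u(1) t(1) u(3)] ne[OF u(1) _ u(4)] t(2) by auto
    with mem[OF u(1)] u(2) True show ?thesis by (metis insertCI)
  next
    case False
    then have v: "v = vs ! ?s" using assms(3) t(2) by auto
    let ?u = "Suc ?s mod ?n"
    have lt: "?s < ?n" "?u < ?n" using t(1) by (auto intro!: mod_less_divisor)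
    have "?u \<noteq> t" "?u \<noteq> ?s"
      using t(1) vs(1) s by (auto simp: mod_Suc split: if_splits)
    then have "vs ! ?u \<notin> e"
      using ne[OF lt(2) t(1)] ne[OF lt(2,1)] t(2) by auto
    with mem[OF lt(1)] v show ?thesis by (metis insertCI)
  qed
qed

section \<open>Switches with one class held fixed\<close>

definition cubic :: "'v graph \<Rightarrow> bool" where
  "cubic G \<longleftrightarrow> finite (edges G) \<and> (\<forall>e\<in>edges G. card e = 2) \<and>
     (\<forall>v\<in>\<Union>(edges G). card {e \<in> edges G. v \<in> e} = 3)"

text \<open>The three edges at \<open>v\<close> lie in different classes; if \<open>B\<close> missed
  \<open>v\<close>, they would map injectively to the two other classes.\<close>

lemma coloring_class_meets_vertex:
  assumes "cubic G" "C \<in> three_edge_colorings G" "B \<in> C" "v \<in> \<Union>(edges G)"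
  shows "\<exists>e\<in>B. v \<in> e"
proof (rule ccontr)
  assume no: "\<not> ?thesis"
  let ?I = "{e \<in> edges G. v \<in> e}"
  have C: "\<Union>C = edges G" "card C = 3"
    and m: "\<And>A e f. \<lbrakk>A \<in> C; e \<in> A; f \<in> A; e \<noteq> f\<rbrakk> \<Longrightarrow> e \<inter> f = {}"
    using assms(2) by (auto simp: three_edge_colorings_def partition_on_def)
  have "\<forall>e\<in>?I. \<exists>A\<in>C. e \<in> A" using C by blast
  then obtain g where g: "\<And>e. e \<in> ?I \<Longrightarrow> g e \<in> C \<and> e \<in> g e" by metis
  have "inj_on g ?I"
  proof (rule inj_onI, rule ccontr)
    fix e f assume *: "e \<in> ?I" "f \<in> ?I" "g e = g f" "e \<noteq> f"
    then show False using m[of "g e" e f] g[of e] g[of f] by auto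
  qed
  moreover have "g ` ?I \<subseteq> C - {B}" using g no by blast
  moreover have fin: "finite C" using C(2) by (simp add: card_ge_0_finite)
  ultimately have "card ?I \<le> card (C - {B})"
    by (metis card_image card_mono finite_Diff)
  also have "\<dots> = 2" using fin assms(3) C(2) by simp
  also have "card ?I = 3" using assms(1,4) unfolding cubic_def by blast
  finally show False by simp
qed

lemma three_classes_coloring_iff:
  assumes "distinct [A, B1, B2]"
  shows "{A, B1, B2} \<in> three_edge_colorings G \<longleftrightarrow>
    (A \<noteq> {} \<and> B1 \<noteq> {} \<and> B2 \<noteq> {}) \<and>
    (A \<union> B1 \<union> B2 = edges G \<and> A \<inter> B1 = {} \<and> A \<inter> B2 = {} \<and> B1 \<inter> B2 = {}) \<and>
    (\<forall>Z\<in>{A, B1, B2}. \<forall>e\<in>Z. \<forall>f\<in>Z. e \<noteq> f \<longrightarrow> e \<inter> f = {})"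
proof -
  have "partition_on E {A, B1, B2} \<longleftrightarrow> (A \<noteq> {} \<and> B1 \<noteq> {} \<and> B2 \<noteq> {}) \<and>
      (A \<union> B1 \<union> B2 = E \<and> A \<inter> B1 = {} \<and> A \<inter> B2 = {} \<and> B1 \<inter> B2 = {})" for E
  proof -
    have "disjoint {A, B1, B2} \<longleftrightarrow> A \<inter> B1 = {} \<and> A \<inter> B2 = {} \<and> B1 \<inter> B2 = {}"
    proof
      assume d: "disjoint {A, B1, B2}"
      show "A \<inter> B1 = {} \<and> A \<inter> B2 = {} \<and> B1 \<inter> B2 = {}"
        using disjointD[OF d, of A B1] disjointD[OF d, of A B2] disjointD[OF d, of B1 B2] assms by simp
    next
      assume h: "A \<inter> B1 = {} \<and> A \<inter> B2 = {} \<and> B1 \<inter> B2 = {}"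
      show "disjoint {A, B1, B2}"
      proof (rule disjointI)
        fix a b assume "a \<in> {A, B1, B2}" "b \<in> {A, B1, B2}" "a \<noteq> b"
        then show "a \<inter> b = {}" using h by (elim insertE emptyE) (simp_all add: Int_commute)
      qed
    qed
    moreover have "\<Union>{A, B1, B2} = A \<union> B1 \<union> B2" by blast
    ultimately show ?thesis unfolding partition_on_def by blast
  qed
  moreover have "card {A, B1, B2} = 3" using assms by simp
  ultimately show ?thesis unfolding three_edge_colorings_def by simp
qed

text \<open>Induction on the number of edges of \<open>B1\<close> outside \<open>D1\<close>, which
  each switch along a cycle of differing edges lowers.\<close>

lemma shared_class_imp_kempe:
  assumes "cubic G" "C \<in> three_edge_colorings G" "D \<in> three_edge_colorings G"
    and "A \<in> C" "A \<in> D"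
  shows "(C, D) \<in> (kempe_switch G)\<^sup>*"
proof -
  have split: "\<exists>B1 B2. C = {A, B1, B2} \<and> distinct [A, B1, B2]"
    if "C \<in> three_edge_colorings G" "A \<in> C" for C
  proof -
    have "card C = 3" using that(1) by (simp add: three_edge_colorings_def)
    then have "card (C - {A}) = 2" using that(2) by (simp add: card_Diff_singleton)
    then obtain B1 B2 where "C - {A} = {B1, B2}" "B1 \<noteq> B2" by (meson card_2_iff)
    then have "C = {A, B1, B2} \<and> distinct [A, B1, B2]" using that(2) by auto
    then show ?thesis by blast
  qed
  obtain D1 D2 where D: "D = {A, D1, D2}" "distinct [A, D1, D2]"
    using split[OF assms(3,5)] by blast
  have Ds: "A \<union> D1 \<union> D2 = edges G" "A \<inter> D1 = {}" "A \<inter> D2 = {}" "D1 \<inter> D2 = {}"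
    and Dm: "\<And>Z e f v. \<lbrakk>Z \<in> {A, D1, D2}; e \<in> Z; f \<in> Z; v \<in> e; v \<in> f\<rbrakk> \<Longrightarrow> e = f"
    using assms(3)[unfolded D(1) three_classes_coloring_iff[OF D(2)]] by (simp, simp, simp, simp, fast)
  have fin: "finite (edges G)" and two: "\<And>e. e \<in> edges G \<Longrightarrow> card e = 2"
    using assms(1) by (auto simp: cubic_def)
  have main: "({A, B1, B2}, D) \<in> (kempe_switch G)\<^sup>*"
    if "{A, B1, B2} \<in> three_edge_colorings G" "distinct [A, B1, B2]" for B1 B2
    using that
  proof (induction "card (B1 - D1)" arbitrary: B1 B2 rule: less_induct)
    case less
    have Cs: "A \<union> B1 \<union> B2 = edges G" "A \<inter> B1 = {}" "A \<inter> B2 = {}" "B1 \<inter> B2 = {}"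
      and Cm: "\<And>Z e f v. \<lbrakk>Z \<in> {A, B1, B2}; e \<in> Z; f \<in> Z; v \<in> e; v \<in> f\<rbrakk> \<Longrightarrow> e = f"
      and Ane: "A \<noteq> {}"
      using less.prems(1)[unfolded three_classes_coloring_iff[OF less.prems(2)]] by (simp, simp, simp, simp, fast, simp)
    \<comment> \<open>As \<open>A\<close> is common, \<open>B1\<close> and \<open>B2\<close> cover
      the same edges as \<open>D1\<close> and \<open>D2\<close>, so \<open>?S\<close> holds exactly
      the edges on which the colorings differ.\<close>
    let ?S = "(B1 \<inter> D2) \<union> (B2 \<inter> D1)"
    have B: "B1 \<subseteq> edges G" "B2 \<subseteq> edges G" using Cs by auto
    show ?case
    proof (cases "?S = {}")
      case True
      have "B1 = D1" "B2 = D2" using True Cs Ds by blast+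
      then show ?thesis using D by simp
    next
      case False
      have meet: "\<exists>e\<in>Z. v \<in> e" if "Z \<in> {A, B1, B2}" "e \<in> edges G" "v \<in> e" for Z e v
        using coloring_class_meets_vertex[OF assms(1) less.prems(1) that(1)] that(2,3) by blast
      \<comment> \<open>The edge \<open>e'\<close> at \<open>v\<close> from the other class cannot
        lie in the same class of \<open>D\<close> as \<open>e\<close>, so it is a differing edge as
        well.\<close>
      have "\<exists>e'\<in>?S. v \<in> e' \<and> e' \<noteq> e" if e: "e \<in> ?S" "v \<in> e" for e v
      proof (cases "e \<in> B1")
        case True
        then obtain e' where e': "e' \<in> B2" "v \<in> e'" using meet[of B2 e v] e B by blast
        then have "e' \<noteq> e" "e' \<in> D1 \<union> D2" using True Cs Ds by blast+
        moreover have "e \<in> D2" using True e Cs by blast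
        ultimately have "e' \<in> D1" using Dm[of D2 e e' v] e' e(2) by blast
        then show ?thesis using e' \<open>e' \<noteq> e\<close> by blast
      next
        case False
        then obtain e' where e': "e' \<in> B1" "v \<in> e'" using meet[of B1 e v] e B by blast
        then have "e' \<noteq> e" "e' \<in> D1 \<union> D2" using False Cs Ds by blast+
        moreover have "e \<in> D1" using False e by blast
        ultimately have "e' \<in> D2" using Dm[of D1 e e' v] e' e(2) by blast
        then show ?thesis using e' \<open>e' \<noteq> e\<close> by blast
      qed
      moreover have "finite ?S" using finite_subset[OF _ fin] B by blast
      moreover have "card e = 2" if "e \<in> ?S" for e using that two B by blast
      ultimately obtain K where K: "K \<subseteq> ?S" "is_cycle K"
        using ex_cycle_if_min_degree_2[of ?S] False by blast
      let ?B1 = "(B1 - K) \<union> (B2 \<inter> K)" and ?B2 = "(B2 - K) \<union> (B1 \<inter> K)"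
      have deg: "\<exists>e'\<in>K. v \<in> e' \<and> e' \<noteq> e" if "e \<in> K" "v \<in> e" for e v
        using cycle_degree_2[OF K(2) that] .
      have KB: "K \<subseteq> B1 \<union> B2" using K by blast
      \<comment> \<open>If an unswitched edge \<open>e\<close> of \<open>Z1\<close> met a switched
        edge \<open>f\<close> of \<open>Z2\<close>, the second cycle edge at the common vertex would
        lie in \<open>Z1\<close> and thus equal \<open>e\<close>, which is outside
        \<open>K\<close>.\<close>
      have cross: "e \<inter> f = {}"
        if Z: "Z1 = B1 \<and> Z2 = B2 \<or> Z1 = B2 \<and> Z2 = B1" and ef: "e \<in> Z1 - K" "f \<in> Z2 \<inter> K"
        for e f Z1 Z2
      proof (rule ccontr)
        assume "e \<inter> f \<noteq> {}"
        then obtain v where v: "v \<in> e" "v \<in> f" by blast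
        obtain f' where f': "f' \<in> K" "v \<in> f'" "f' \<noteq> f" using deg[of f v] ef v by blast
        have "f' \<notin> Z2" using f' v ef Z Cm[of Z2 f f' v] by blast
        then have "f' \<in> Z1" using f' KB Z by blast
        then have "f' = e" using f' v ef Z Cm[of Z1 f' e v] by blast
        then show False using f' ef by blast
      qed
      obtain x where "x \<in> K" using K(2) by (fastforce simp: is_cycle_def cycle_edges_def)
      then have "card x = 2" using KB B two by blast
      then obtain v where "v \<in> x" by fastforce
      obtain y where y: "y \<in> K" "v \<in> y" "y \<noteq> x" using deg[OF \<open>x \<in> K\<close> \<open>v \<in> x\<close>] by blast
      \<comment> \<open>Adjacent edges of the cycle cannot share a class. That \<open>K\<close>
        meets both classes keeps the new ones nonempty and makes the measure drop.\<close>
      have both: "K \<inter> B1 \<noteq> {}" "K \<inter> B2 \<noteq> {}"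
      proof -
        have "\<not> (x \<in> B1 \<and> y \<in> B1)" "\<not> (x \<in> B2 \<and> y \<in> B2)"
          using y \<open>v \<in> x\<close> Cm[of B1 x y v] Cm[of B2 x y v] by auto
        then show "K \<inter> B1 \<noteq> {}" "K \<inter> B2 \<noteq> {}" using y(1) \<open>x \<in> K\<close> KB by auto
      qed
      have sets: "A \<union> ?B1 \<union> ?B2 = edges G" "A \<inter> ?B1 = {}" "A \<inter> ?B2 = {}" "?B1 \<inter> ?B2 = {}"
        using Cs KB by blast+
      have ne: "?B1 \<noteq> {}" "?B2 \<noteq> {}" using both by blast+
      have dist: "distinct [A, ?B1, ?B2]"
      proof -
        have "A \<noteq> ?B1" "A \<noteq> ?B2" "?B1 \<noteq> ?B2" using sets(2-4) ne Ane by (metis Int_absorb)+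
        then show ?thesis by simp
      qed
      have match: "e \<inter> f = {}"
        if Z: "Z = A \<or> Z = ?B1 \<or> Z = ?B2" and ef: "e \<in> Z" "f \<in> Z" "e \<noteq> f" for Z e f
      proof -
        consider (same) Z' where "Z' \<in> {A, B1, B2}" "e \<in> Z'" "f \<in> Z'"
          | "e \<in> B1 - K" "f \<in> B2 \<inter> K" | "e \<in> B2 - K" "f \<in> B1 \<inter> K"
          | "f \<in> B1 - K" "e \<in> B2 \<inter> K" | "f \<in> B2 - K" "e \<in> B1 \<inter> K"
          using Z ef(1,2) by blast
        then show ?thesis
        proof cases
          case same then show ?thesis using Cm[of Z' e f] ef(3) by blast
        next
          case 2 then show ?thesis using cross[of B1 B2 e f] by blast
        next
          case 3 then show ?thesis using cross[of B2 B1 e f] by blast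
        next
          case 4 then show ?thesis using cross[of B1 B2 f e] by blast
        next
          case 5 then show ?thesis using cross[of B2 B1 f e] by blast
        qed
      qed
      have new: "{A, ?B1, ?B2} \<in> three_edge_colorings G"
      proof -
        have "\<forall>Z\<in>{A, ?B1, ?B2}. \<forall>e\<in>Z. \<forall>f\<in>Z. e \<noteq> f \<longrightarrow> e \<inter> f = {}"
        proof (intro ballI impI)
          fix Z e f assume *: "Z \<in> {A, ?B1, ?B2}" "e \<in> Z" "f \<in> Z" "e \<noteq> f"
          from *(1) have "Z = A \<or> Z = ?B1 \<or> Z = ?B2" by simp
          from match[OF this *(2-4)] show "e \<inter> f = {}" .
        qed
        with sets ne Ane show ?thesis unfolding three_classes_coloring_iff[OF dist] by (intro conjI)
      qed
      have "({A, B1, B2}, {A, ?B1, ?B2}) \<in> kempe_switch G"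
      proof -
        have "{A, ?B1, ?B2} = ({A, B1, B2} - {B1, B2}) \<union> {?B1, ?B2}"
          using less.prems(2) by auto
        moreover have "B1 \<noteq> B2" using less.prems(2) by auto
        ultimately show ?thesis
          unfolding kempe_switch_def using less.prems(1) K(2) KB by blast
      qed
      moreover have "({A, ?B1, ?B2}, D) \<in> (kempe_switch G)\<^sup>*"
      proof (rule less.hyps[OF _ new dist])
        \<comment> \<open>Edges leaving \<open>B1\<close> lie in \<open>D2\<close>, and edges
          entering it lie in \<open>D1\<close>.\<close>
        have "?B1 - D1 \<subset> B1 - D1" using K(1) both(1) Cs(4) Ds(4) by blast
        moreover have "finite (B1 - D1)" using finite_subset[OF B(1) fin] by blast
        ultimately show "card (?B1 - D1) < card (B1 - D1)" by (rule psubset_card_mono[rotated])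
      qed
      ultimately show ?thesis by (rule converse_rtrancl_into_rtrancl)
    qed
  qed
  show ?thesis using split[OF assms(2,4)] main assms(2) by blast
qed

section \<open>Color patterns on three ladders\<close>

text \<open>One type serves for the colors and for the three ladders, so the colors at one end of
  the ladders form a permutation.\<close>

datatype three = One | Two | Three

lemma UNIV_three: "UNIV = {One, Two, Three}"
  using three.exhaust by auto

instance three :: finite
  by standard (simp add: UNIV_three)

lemma all_three: "(\<forall>c. P c) \<longleftrightarrow> P One \<and> P Two \<and> P Three"
  by (metis three.exhaust)

lemma inj_three_permutes:
  fixes p :: "three \<Rightarrow> three"
  assumes "inj p"
  shows "p permutes UNIV"
  using assms by (intro bij_imp_permutes) (auto simp: bij_def finite_UNIV_inj_surj)

text \<open>Also applied to \<open>x = y\<close>, where it gives some color other than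
  \<open>x\<close>.\<close>

definition third :: "three \<Rightarrow> three \<Rightarrow> three" where
  "third x y = (SOME z. z \<noteq> x \<and> z \<noteq> y)"

lemma third_neq: "third x y \<noteq> x" "third x y \<noteq> y"
proof -
  have "\<exists>z. z \<noteq> x \<and> z \<noteq> y" by (cases x; cases y) auto
  then have "third x y \<noteq> x \<and> third x y \<noteq> y" unfolding third_def by (rule someI_ex)
  then show "third x y \<noteq> x" "third x y \<noteq> y" by auto
qed

lemma three_cases:
  fixes p q r :: three
  assumes "p \<noteq> q" "p \<noteq> r" "q \<noteq> r"
  shows "x = p \<or> x = q \<or> x = r"
  using assms by (cases x; cases p; cases q; cases r) auto

lemma third_eqI: "\<lbrakk>x \<noteq> y; z \<noteq> x; z \<noteq> y\<rbrakk> \<Longrightarrow> third x y = z"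
  using three_cases[of x y "third x y" z] third_neq[of x y] by auto

section \<open>Walks in the complete graph on three colors\<close>

text \<open>Colors along one rail of a ladder with \<open>n\<close> rungs; indices \<open>0\<close>
  and \<open>n\<close> belong to the pendant edges, and consecutive edges meet in a vertex.\<close>

definition walk :: "nat \<Rightarrow> (nat \<Rightarrow> three) \<Rightarrow> bool" where
  "walk n h \<longleftrightarrow> (\<forall>t<n. h t \<noteq> h (Suc t))"

text \<open>Models a recoloring that leaves the class of \<open>r\<close> alone; the ends are fixed
  so that the conditions at the pendant vertices survive.\<close>

definition walk_step :: "nat \<Rightarrow> (nat \<Rightarrow> three) \<Rightarrow> (nat \<Rightarrow> three) \<Rightarrow> bool" where
  "walk_step n h h' \<longleftrightarrow> walk n h \<and> walk n h' \<and> h 0 = h' 0 \<and> h n = h' n \<and>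
     (\<exists>r. \<forall>t\<le>n. h t = r \<longleftrightarrow> h' t = r)"

lemma walk_cong: "(\<And>t. t \<le> n \<Longrightarrow> h t = h' t) \<Longrightarrow> walk n h \<longleftrightarrow> walk n h'"
  by (simp add: walk_def)

lemma walk_Suc: "walk (Suc n) h \<longleftrightarrow> walk n h \<and> h n \<noteq> h (Suc n)"
  by (auto simp: walk_def less_Suc_eq)

lemma walk_upd: "walk n h \<Longrightarrow> h n \<noteq> v \<Longrightarrow> walk (Suc n) (h(Suc n := v))"
  by (auto simp: walk_Suc walk_def)

lemma ex_walk:
  assumes "1 \<le> n" "n = 1 \<longrightarrow> u \<noteq> v"
  shows "\<exists>h. walk n h \<and> h 0 = u \<and> h n = v"
  using assms
proof (induction n arbitrary: v)
  case (Suc n)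
  show ?case
  proof (cases n)
    case 0
    then show ?thesis using Suc.prems
      by (intro exI[of _ "\<lambda>t. if t = 0 then u else v"]) (simp add: walk_def)
  next
    case (Suc m)
    \<comment> \<open>\<open>third u v\<close> differs from \<open>v\<close>, which allows the last
      step, and from \<open>u\<close>, as the induction hypothesis demands for length 1.\<close>
    then obtain h where "walk n h" "h 0 = u" "h n = third u v"
      using Suc.IH[of "third u v"] third_neq(1)[of u v] by auto
    then have "walk (Suc n) (h(Suc n := v)) \<and> (h(Suc n := v)) 0 = u \<and> (h(Suc n := v)) (Suc n) = v"
      using third_neq(2)[of u v] by (intro conjI walk_upd) simp_all
    then show ?thesis by (intro exI[of _ "h(Suc n := v)"])
  qed
qed simp

text \<open>Steps fix the value at \<open>n\<close>, so the appended color \<open>v\<close> differs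
  from it throughout the chain.\<close>

lemma walk_steps_upd:
  assumes "(walk_step n)\<^sup>*\<^sup>* h h'" "h n \<noteq> v"
  shows "(walk_step (Suc n))\<^sup>*\<^sup>* (h(Suc n := v)) (h'(Suc n := v))"
  using assms(1)
proof induction
  case (step g g')
  have "h n = g n"
    using step.hyps(1) by induction (auto simp: walk_step_def)
  then have "walk_step (Suc n) (g(Suc n := v)) (g'(Suc n := v))"
    using step.hyps(2) assms(2) by (fastforce simp: walk_step_def walk_upd le_Suc_eq)
  with step.IH show ?case by (metis rtranclp.rtrancl_into_rtrancl)
qed simp

lemma walk_step_agree:
  assumes "walk n h" "\<And>t. t \<le> n \<Longrightarrow> h t = h' t"
  shows "walk_step n h h'"
  using assms walk_cong[of n h h'] by (auto simp: walk_step_def)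

text \<open>
  If the two walks differ just before the end, both are first rerouted so that they
  agree up to a visit of their common end colour two steps before that.
\<close>

lemma walks_connected:
  assumes "walk n h" "walk n h'" "h 0 = h' 0" "h n = h' n"
  shows "(walk_step n)\<^sup>*\<^sup>* h h'"
  using assms
proof (induction n arbitrary: h h')
  case 0
  then show ?case by (intro r_into_rtranclp walk_step_agree) auto
next
  case (Suc n)
  define r where "r = h (Suc n)"
  have upd: "h(Suc n := r) = h" "h'(Suc n := r) = h'"
    using Suc.prems(4) by (auto simp: r_def)
  have w: "walk n h" "walk n h'" "h n \<noteq> r" "h' n \<noteq> r"
    using Suc.prems by (auto simp: walk_Suc r_def)
  show ?case
  proof (cases "h n = h' n")
    case True
    from walk_steps_upd[OF Suc.IH[OF w(1,2) Suc.prems(3) True] w(3)] show ?thesis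
      by (simp only: upd)
  next
    case False
    then obtain m where m: "n = Suc m" using Suc.prems(3) by (cases n) auto
    show ?thesis
    \<comment> \<open>The short cases that \<open>ex_walk\<close> does not cover; there
      \<open>r\<close> sits at the same places in both walks.\<close>
    proof (cases "m = 0 \<or> m = 1 \<and> h 0 = r")
      case True
      have "h t = r \<longleftrightarrow> h' t = r" if "t \<le> Suc n" for t
      proof (cases "t = 0")
        case False
        have "t = 1 \<or> t = 2 \<or> m = 1 \<and> t = 3" using that True m False by auto
        moreover have "m = 1 \<Longrightarrow> h 1 \<noteq> r \<and> h' 1 \<noteq> r"
          using True w(1,2) Suc.prems(3) m by (auto simp: walk_def)
        ultimately show ?thesis using True m w(3,4) Suc.prems(4)
          by (auto simp: r_def numeral_2_eq_2 numeral_3_eq_3)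
      qed (simp add: Suc.prems(3))
      then show ?thesis using Suc.prems by (auto simp: walk_step_def)
    next
      case F: False
      then obtain k where k: "walk m k" "k 0 = h 0" "k m = r"
        using ex_walk[of m "h 0" r] by auto
      \<comment> \<open>The beginning is replaced by \<open>k\<close>, which reaches
        \<open>r\<close> at \<open>m\<close>, just before \<open>n\<close>; the value at
        \<open>n\<close> is kept, so the induction hypothesis for length \<open>n\<close>
        applies.\<close>
      have reroute: "(walk_step (Suc n))\<^sup>*\<^sup>* g (k(n := g n, Suc n := r)) \<and>
          (walk_step (Suc n))\<^sup>*\<^sup>* (k(n := g n, Suc n := r)) g"
        if g: "walk n g" "g 0 = h 0" "g n \<noteq> r" "g(Suc n := r) = g" for g
      proof -
        let ?k = "k(n := g n)"
        have kw: "walk n ?k" using k g(3) m by (auto intro: walk_upd)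
        have k0: "?k 0 = g 0" "?k n = g n" using m k g by simp_all
        have "(walk_step n)\<^sup>*\<^sup>* g ?k" "(walk_step n)\<^sup>*\<^sup>* ?k g"
          by (rule Suc.IH[OF g(1) kw k0[symmetric]], rule Suc.IH[OF kw g(1) k0])
        then show ?thesis
          using walk_steps_upd[of n g ?k r] walk_steps_upd[of n ?k g r] g(3,4) by simp
      qed
      \<comment> \<open>The rerouted walks differ only at \<open>n\<close>, where neither has color
        \<open>r\<close>.\<close>
      have "walk_step (Suc n) (k(n := h n, Suc n := r)) (k(n := h' n, Suc n := r))"
        using k w(3,4) m by (auto simp: walk_step_def intro!: walk_upd exI[of _ r])
      then show ?thesis
        using reroute[OF w(1) _ w(3) upd(1)] reroute[OF w(2) _ w(4) upd(2)] Suc.prems(3)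
        by (metis rtranclp.rtrancl_into_rtrancl rtranclp_trans)
    qed
  qed
qed

text \<open>In positive even length, a single intermediate color joins any two ends \<open>u\<close>
  and \<open>v\<close>, equal or not.\<close>

definition zigzag :: "three \<Rightarrow> three \<Rightarrow> three \<Rightarrow> nat \<Rightarrow> three" where
  "zigzag u w v t = (if t = 0 then u else if odd t then w else v)"

lemma walk_zigzag: "\<lbrakk>w \<noteq> u; w \<noteq> v\<rbrakk> \<Longrightarrow> walk n (zigzag u w v)"
  by (auto simp: walk_def zigzag_def)

section \<open>States of three ladders of even length\<close>

locale even_lengths =
  fixes n :: "three \<Rightarrow> nat"
  assumes n_pos: "0 < n c" and n_even: "even (n c)"
begin

lemma zigzag_ends [simp]: "zigzag u w v 0 = u" "zigzag u w v (n c) = v"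
  using n_pos[of c] n_even[of c] by (auto simp: zigzag_def)

text \<open>\<open>F c s t\<close> is the color of edge \<open>t\<close> on a rail of ladder
  \<open>c\<close>, the \<open>X\<close> rail for true \<open>s\<close>. Rungs are implicit: both
  rails show the same pair of colors beside a rung, which takes the remaining color. Injectivity
  expresses properness at the merged pendant vertices.\<close>

definition state :: "(three \<Rightarrow> bool \<Rightarrow> nat \<Rightarrow> three) \<Rightarrow> bool" where
  "state F \<longleftrightarrow>
     (\<forall>c s. walk (n c) (F c s)) \<and>
     (\<forall>c. \<forall>t<n c. {F c True t, F c True (Suc t)} = {F c False t, F c False (Suc t)}) \<and>
     (\<forall>s. inj (\<lambda>c. F c s 0)) \<and> (\<forall>s. inj (\<lambda>c. F c s (n c)))"

text \<open>The places of \<open>r\<close> on the rails determine those on the rungs, so the two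
  colorings share the class of \<open>r\<close>.\<close>

definition step :: "(three \<Rightarrow> bool \<Rightarrow> nat \<Rightarrow> three) \<Rightarrow> (three \<Rightarrow> bool \<Rightarrow> nat \<Rightarrow> three) \<Rightarrow> bool" where
  "step F F' \<longleftrightarrow> state F \<and> state F' \<and>
     (\<exists>r. \<forall>c s. \<forall>t\<le>n c. F c s t = r \<longleftrightarrow> F' c s t = r)"

abbreviation conn where "conn \<equiv> step\<^sup>*\<^sup>*"

lemma conn_sym: "conn F F' \<Longrightarrow> conn F' F"
proof -
  have "symp step" by (rule sympI) (metis step_def)
  then show "conn F F' \<Longrightarrow> conn F' F" by (metis sympD symp_rtranclp)
qed

text \<open>Equal rails satisfy the rung condition of \<open>state\<close> trivially, so each ladder
  can be changed on its own.\<close>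

definition flat :: "(three \<Rightarrow> nat \<Rightarrow> three) \<Rightarrow> three \<Rightarrow> bool \<Rightarrow> nat \<Rightarrow> three" where
  "flat h c s t = h c t"

lemma state_flat:
  "state (flat h) \<longleftrightarrow>
     (\<forall>c. walk (n c) (h c)) \<and> inj (\<lambda>c. h c 0) \<and> inj (\<lambda>c. h c (n c))"
  by (auto simp: state_def flat_def walk_def)

text \<open>The ends of the walk are fixed and the other ladders untouched, so a step of one walk is
  a step of the whole state for the same \<open>r\<close>.\<close>

lemma conn_flat_upd:
  assumes "state (flat h)" "(walk_step (n d))\<^sup>*\<^sup>* (h d) g"
  shows "conn (flat h) (flat (h(d := g)))"
  using assms(2)
proof induction
  case (step g g')
  have ends: "h d 0 = g 0 \<and> h d (n d) = g (n d)"
    using step.hyps(1) by induction (auto simp: walk_step_def)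
  have "state (flat (h(d := f)))"
    if "walk (n d) f" "f 0 = h d 0" "f (n d) = h d (n d)" for f
  proof -
    have "(\<lambda>c. (h(d := f)) c 0) = (\<lambda>c. h c 0)" "(\<lambda>c. (h(d := f)) c (n c)) = (\<lambda>c. h c (n c))"
      using that by (auto simp: fun_eq_iff)
    then show ?thesis using assms(1) that(1) by (simp add: state_flat)
  qed
  then have "step (flat (h(d := g))) (flat (h(d := g')))"
    using step.hyps(2) ends unfolding step_def walk_step_def flat_def by auto
  with step.IH show ?case by (metis rtranclp.rtrancl_into_rtrancl)
qed simp

lemma conn_flat_same_ends:
  assumes h: "state (flat h)" and g: "state (flat g)"
    and "\<And>c. h c 0 = g c 0" "\<And>c. h c (n c) = g c (n c)"
  shows "conn (flat h) (flat g)"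
proof -
  have steps: "(walk_step (n d))\<^sup>*\<^sup>* (h d) (g d)" for d
    using walks_connected assms by (simp add: state_flat)
  have st: "state (flat (\<lambda>c. if c \<in> A then g c else h c))" for A
  proof -
    have "(\<lambda>c. (if c \<in> A then g c else h c) 0) = (\<lambda>c. h c 0)"
      "(\<lambda>c. (if c \<in> A then g c else h c) (n c)) = (\<lambda>c. h c (n c))"
      using assms(3,4) by (auto simp: fun_eq_iff)
    then show ?thesis using h g by (auto simp: state_flat)
  qed
  \<comment> \<open>The ladders are replaced one at a time; \<open>A\<close> collects those already
    done.\<close>
  have "conn (flat h) (flat (\<lambda>c. if c \<in> A then g c else h c))" for A
  proof (induction A rule: finite_induct[OF finite])
    case (2 d A)
    have "(\<lambda>c. if c \<in> A then g c else h c)(d := g d) = (\<lambda>c. if c \<in> insert d A then g c else h c)"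
      using 2 by auto
    then show ?case
      using 2 conn_flat_upd[OF st[of A], of d "g d"] steps[of d] by (auto intro: rtranclp_trans)
  qed simp
  from this[of UNIV] show ?thesis by simp
qed

section \<open>Zigzag walks and permutations of the left end\<close>

text \<open>
  Transposing the two colours other than \<open>r\<close> at the left end, with right ends unchanged: the
  zigzags are chosen to have \<open>r\<close> in the same places before and after.
\<close>

definition mid :: "three \<Rightarrow> three \<Rightarrow> three \<Rightarrow> three" where
  "mid r u v = (if u = r \<or> v = r then third u v else r)"

definition zigzags :: "three \<Rightarrow> (three \<Rightarrow> three) \<Rightarrow> (three \<Rightarrow> three) \<Rightarrow> three \<Rightarrow> nat \<Rightarrow> three" where
  "zigzags r a e c = zigzag (a c) (mid r (a c) (e c)) (e c)"

lemma state_zigzags: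
  assumes "inj a" "inj e"
  shows "state (flat (zigzags r a e))"
proof -
  have "walk (n c) (zigzags r a e c)" for c
    unfolding zigzags_def by (rule walk_zigzag) (auto simp: mid_def third_neq)
  then show ?thesis using assms by (simp add: state_flat zigzags_def)
qed

lemma conn_zigzags_index:
  assumes "inj a" "inj e"
  shows "conn (flat (zigzags r a e)) (flat (zigzags r' a e))"
  by (rule conn_flat_same_ends[OF state_zigzags[OF assms] state_zigzags[OF assms]])
    (simp_all add: zigzags_def)

lemma conn_zigzags_transpose:
  assumes "inj a" "inj e" "p \<noteq> q"
  shows "conn (flat (zigzags r a e)) (flat (zigzags r' (transpose p q \<circ> a) e))"
proof -
  \<comment> \<open>The color fixed by the transposition; once the index has been changed to
    \<open>s\<close>, a single step performs it.\<close>
  define s where "s = third p q"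
  let ?a = "transpose p q \<circ> a"
  have s: "s \<noteq> p" "s \<noteq> q" by (auto simp: s_def third_neq)
  have a: "inj ?a" using assms(1) by (simp add: inj_compose)
  have tr: "?a c = s \<longleftrightarrow> a c = s" for c using s by (auto simp: transpose_def)
  \<comment> \<open>For a left end other than \<open>s\<close>, before and after transposing, the
    middle color is \<open>s\<close> exactly if the right end is not.\<close>
  have eq: "zigzags s a e c t = s \<longleftrightarrow> zigzags s ?a e c t = s" for c t
  proof (cases "a c = s")
    case True
    then have "?a c = a c" using tr by metis
    then show ?thesis by (simp add: zigzags_def)
  next
    case False
    then show ?thesis using tr[of c]
      by (auto simp: zigzags_def zigzag_def mid_def third_neq)
  qed
  have "conn (flat (zigzags r a e)) (flat (zigzags s a e))"
    by (rule conn_zigzags_index[OF assms(1,2)])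
  moreover have "step (flat (zigzags s a e)) (flat (zigzags s ?a e))"
    using eq state_zigzags[OF assms(1,2)] state_zigzags[OF a assms(2)]
    unfolding step_def flat_def by blast
  moreover have "conn (flat (zigzags s ?a e)) (flat (zigzags r' ?a e))"
    by (rule conn_zigzags_index[OF a assms(2)])
  ultimately show ?thesis
    by (meson rtranclp.rtrancl_into_rtrancl rtranclp_trans)
qed

lemma conn_zigzags_permute:
  assumes "inj a" "inj e" "inj p"
  shows "conn (flat (zigzags r a e)) (flat (zigzags r (p \<circ> a) e))"
proof -
  from inj_three_permutes[OF assms(3)] finite_UNIV show ?thesis
  proof (induction rule: permutes_induct)
    case (swap x y p)
    have "inj (p \<circ> a)" using swap.hyps assms(1) by (simp add: inj_compose permutes_inj)
    from rtranclp_trans[OF swap.IH conn_zigzags_transpose[OF this assms(2) swap.hyps(3)]]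
    show ?case by (simp only: o_assoc)
  qed auto
qed

section \<open>Renaming colors and the reference state\<close>

lemma state_recolor:
  assumes "state F" "inj p"
  shows "state (\<lambda>c s t. p (F c s t))"
proof -
  have "{p (F c True t), p (F c True (Suc t))} = {p (F c False t), p (F c False (Suc t))}"
    if "t < n c" for c t
  proof -
    have "p ` {F c True t, F c True (Suc t)} = p ` {F c False t, F c False (Suc t)}"
      using assms(1) that by (simp only: state_def)
    then show ?thesis by simp
  qed
  moreover have "inj (\<lambda>c. p (f c))" if "inj f" for f :: "three \<Rightarrow> three"
    using inj_compose[OF assms(2) that] by (simp add: o_def)
  ultimately show ?thesis using assms(1) inj_eq[OF assms(2)] by (simp add: state_def walk_def)
qed

text \<open>A renaming is a product of transpositions, each of which keeps every place of the third
  color.\<close>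

lemma conn_recolor:
  assumes "state F" "inj p"
  shows "conn F (\<lambda>c s t. p (F c s t))"
proof -
  from inj_three_permutes[OF assms(2)] finite_UNIV show ?thesis
  proof (induction rule: permutes_induct)
    case (swap x y p)
    let ?t = "transpose x y"
    have "inj p" "inj (?t \<circ> p)" using swap.hyps by (auto simp: inj_compose permutes_inj)
    moreover have "p u = third x y \<longleftrightarrow> (?t \<circ> p) u = third x y" for u
      using third_neq[of x y] by (auto simp: transpose_def)
    ultimately have "step (\<lambda>c s t. p (F c s t)) (\<lambda>c s t. (?t \<circ> p) (F c s t))"
      unfolding step_def using state_recolor[OF assms(1)] by blast
    with swap.IH show ?case by (metis rtranclp.rtrancl_into_rtrancl)
  qed auto
qed

text \<open>Ladder \<open>c\<close> has color \<open>c\<close> at both ends; the index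
  \<open>One\<close> is an arbitrary choice.\<close>

abbreviation "base \<equiv> flat (zigzags One id id)"

lemma state_base: "state base"
  by (simp add: state_zigzags)

text \<open>Renaming by the inverse of the right-end permutation \<open>e\<close> turns that end
  into the identity. The left end becomes \<open>b\<close>, which is then undone on zigzags.\<close>

lemma conn_flat_base:
  assumes "state (flat h)"
  shows "conn (flat h) base"
proof -
  define a where "a = (\<lambda>c. h c 0)"
  define e where "e = (\<lambda>c. h c (n c))"
  have ae: "inj a" "inj e" using assms by (auto simp: state_flat a_def e_def)
  then have "bij e" by (simp add: bij_def finite_UNIV_inj_surj)
  then have ie: "inj (inv e)" by (simp add: bij_imp_bij_inv bij_is_inj)
  define b where "b = inv e \<circ> a"
  have b: "inj b" using ie ae by (simp add: b_def inj_compose)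
  then have "bij b" by (simp add: bij_def finite_UNIV_inj_surj)
  then have ib: "inj (inv b)" "inv b \<circ> b = id" using b by (auto simp: bij_imp_bij_inv bij_is_inj)
  have h': "state (flat (\<lambda>c t. inv e (h c t)))" "conn (flat h) (flat (\<lambda>c t. inv e (h c t)))"
    using state_recolor[OF assms ie] conn_recolor[OF assms ie] by (simp_all add: flat_def[abs_def])
  have "conn (flat (\<lambda>c t. inv e (h c t))) (flat (zigzags One b id))"
  proof (rule conn_flat_same_ends[OF h'(1)])
    show "inv e (h c (n c)) = zigzags One b id c (n c)" for c
      using inv_f_f[OF ae(2), of c] by (simp add: zigzags_def e_def)
  qed (simp_all add: state_zigzags b, simp add: zigzags_def b_def a_def)
  moreover have "conn (flat (zigzags One b id)) (flat (zigzags One (inv b \<circ> b) id))"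
    using b ib by (intro conn_zigzags_permute) auto
  ultimately have "conn (flat h) (flat (zigzags One (inv b \<circ> b) id))"
    using h'(2) by (meson rtranclp_trans)
  then show ?thesis by (simp only: ib)
qed

section \<open>Reduction of every state to the reference state\<close>

text \<open>
  A ladder whose two pendant edges at one end have different colours has all its rungs in the
  third colour, hence its rails alternate between these two.
\<close>

lemma rails_eq:
  assumes "state F" "F c True 0 = F c False 0" "t \<le> n c"
  shows "F c True t = F c False t"
  using assms(3)
proof (induction t)
  case (Suc t)
  have "{F c True t, F c True (Suc t)} = {F c False t, F c False (Suc t)}"
    "F c True t \<noteq> F c True (Suc t)"
    using assms(1) Suc.prems by (auto simp: state_def walk_def)
  then show ?case using Suc by (auto simp: doubleton_eq_iff)
qed (simp add: assms)

definition alternate :: "three \<Rightarrow> three \<Rightarrow> nat \<Rightarrow> three" where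
  "alternate u v t = (if even t then u else v)"

text \<open>While the rails show different colors, equality of the pairs forces each rail to take
  the color of the other next.\<close>

lemma rails_neq:
  assumes "state F" "F c True 0 \<noteq> F c False 0" "t \<le> n c"
  shows "F c True t = alternate (F c True 0) (F c False 0) t \<and>
    F c False t = alternate (F c False 0) (F c True 0) t"
  using assms(3)
proof (induction t)
  case (Suc t)
  have "{F c True t, F c True (Suc t)} = {F c False t, F c False (Suc t)}"
    using assms(1) Suc.prems by (auto simp: state_def)
  moreover have "F c True t \<noteq> F c False t"
    using Suc assms(2) by (auto simp: alternate_def)
  ultimately have "F c True (Suc t) = F c False t \<and> F c False (Suc t) = F c True t"
    by (auto simp: doubleton_eq_iff)
  then show ?case using Suc by (auto simp: alternate_def)
qed (simp add: alternate_def)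

lemma conn_base_if_equal:
  assumes F: "state F" and "\<And>c. F c True 0 = F c False 0"
  shows "conn F base"
proof -
  let ?G = "flat (\<lambda>c. F c True)"
  have eq: "?G c s t = F c s t" if "t \<le> n c" for c s t
    using rails_eq[OF F assms(2) that] by (cases s) (simp_all add: flat_def)
  have G: "state ?G" using F unfolding state_flat by (simp add: state_def)
  \<comment> \<open>The two states agree at all positions up to \<open>n c\<close>; the step only
    bridges values beyond.\<close>
  have "step F ?G" unfolding step_def using F G eq by auto
  then show ?thesis using conn_flat_base[OF G] by (rule converse_rtranclp_into_rtranclp)
qed

lemma inj_three:
  fixes f :: "three \<Rightarrow> 'b"
  assumes "distinct [l1, l2, l3]"
  shows "inj f \<longleftrightarrow> f l1 \<noteq> f l2 \<and> f l1 \<noteq> f l3 \<and> f l2 \<noteq> f l3"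
proof
  assume "inj f"
  then show "f l1 \<noteq> f l2 \<and> f l1 \<noteq> f l3 \<and> f l2 \<noteq> f l3"
    using assms by (simp add: inj_eq)
next
  assume h: "f l1 \<noteq> f l2 \<and> f l1 \<noteq> f l3 \<and> f l2 \<noteq> f l3"
  have l: "x = l1 \<or> x = l2 \<or> x = l3" for x
    using three_cases[of l1 l2 l3 x] assms by auto
  show "inj f"
  proof (rule injI)
    fix x y assume "f x = f y"
    with l[of x] l[of y] h show "x = y" by (elim disjE conjE) simp_all
  qed
qed

text \<open>The rails of \<open>l1\<close> and \<open>l2\<close> use only \<open>p\<close> and
  \<open>q\<close>; adapting their \<open>True\<close> rails to their \<open>False\<close> rails
  gives a flat state with every \<open>r\<close> in place.\<close>

lemma conn_base_if_transposed:
  assumes F: "state F" and l: "distinct [l1, l2, l3]"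
    and "F l1 True 0 = F l2 False 0" "F l1 False 0 = F l2 True 0" "F l3 True 0 = F l3 False 0"
  shows "conn F base"
proof -
  define p where "p = F l1 True 0"
  define q where "q = F l1 False 0"
  define r where "r = F l3 True 0"
  have inj: "\<And>s. inj (\<lambda>c. F c s 0)" "\<And>s. inj (\<lambda>c. F c s (n c))"
    using F by (auto simp: state_def)
  have pq: "p \<noteq> q" "p \<noteq> r" "q \<noteq> r"
    using inj(1)[of True] assms(3-5) l by (auto simp: inj_three[OF l] p_def q_def r_def)
  let ?h = "\<lambda>c. if c = l1 then alternate q p else if c = l2 then alternate p q else F c True"
  have F1: "F l1 True t = alternate p q t" "F l1 False t = alternate q p t" if "t \<le> n l1" for t
    using rails_neq[OF F _ that] pq by (auto simp: p_def q_def)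
  have F2: "F l2 True t = alternate q p t" "F l2 False t = alternate p q t" if "t \<le> n l2" for t
    using rails_neq[OF F _ that] pq assms(3,4) by (auto simp: p_def q_def)
  have F3: "F l3 True t = F l3 False t" if "t \<le> n l3" for t
    using rails_eq[OF F assms(5) that] .
  have wF: "walk (n c) (F c True)" for c using F by (simp add: state_def)
  have three: "c = l1 \<or> c = l2 \<or> c = l3" for c using three_cases[of l1 l2 l3] l by auto
  \<comment> \<open>By even length, the \<open>True\<close> rails of \<open>l1\<close> and
    \<open>l2\<close> end with \<open>p\<close> and \<open>q\<close> as they began, which leaves
    \<open>r\<close> for the end of \<open>l3\<close>.\<close>
  have end3: "F l3 True (n l3) \<noteq> p" "F l3 True (n l3) \<noteq> q"
    using inj(2)[of True] F1(1)[of "n l1"] F2(1)[of "n l2"] n_even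
    by (auto simp: inj_three[OF l] alternate_def)
  have G: "state (flat ?h)"
    unfolding state_flat inj_three[OF l] using l pq wF end3 n_even
    by (auto simp: walk_def alternate_def r_def)
  have "flat ?h c s t = r \<longleftrightarrow> F c s t = r" if "t \<le> n c" for c s t
    using three[of c] F1[of t] F2[of t] F3[of t] l pq that
    by (cases s; cases "even t") (auto simp: flat_def alternate_def)
  then have "step F (flat ?h)" unfolding step_def using F G by blast
  then show ?thesis using conn_flat_base[OF G] by (rule converse_rtranclp_into_rtranclp)
qed

lemma conn_base_if_cyclic:
  assumes F: "state F" and l: "distinct [l1, l2, l3]"
    and "F l1 False 0 = F l2 True 0" "F l2 False 0 = F l3 True 0" "F l3 False 0 = F l1 True 0"
  shows "conn F base"
proof -
  define p where "p = F l1 True 0"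
  define q where "q = F l2 True 0"
  define r where "r = F l3 True 0"
  have inj: "\<And>s. inj (\<lambda>c. F c s 0)" "\<And>s. inj (\<lambda>c. F c s (n c))"
    using F by (auto simp: state_def)
  have pq: "p \<noteq> q" "p \<noteq> r" "q \<noteq> r"
    using inj(1)[of True] l by (auto simp: inj_three[OF l] p_def q_def r_def)
  \<comment> \<open>\<open>p\<close> and \<open>q\<close> are interchanged on the
    \<open>True\<close> rail of \<open>l1\<close> and on both rails of \<open>l2\<close>. This makes
    the rails of \<open>l1\<close> equal and leaves a transposition of \<open>l2\<close> and
    \<open>l3\<close>.\<close>
  let ?G = "\<lambda>c s. if c = l1 then alternate q p
    else if c = l2 then (if s then alternate p r else alternate r p)
    else (if s then alternate r p else alternate p r)"
  have F1: "F l1 True t = alternate p q t" "F l1 False t = alternate q p t" if "t \<le> n l1" for t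
    using rails_neq[OF F _ that] pq assms(3-5) by (auto simp: p_def q_def)
  have F2: "F l2 True t = alternate q r t" "F l2 False t = alternate r q t" if "t \<le> n l2" for t
    using rails_neq[OF F _ that] pq assms(3-5) by (auto simp: r_def q_def)
  have F3: "F l3 True t = alternate r p t" "F l3 False t = alternate p r t" if "t \<le> n l3" for t
    using rails_neq[OF F _ that] pq assms(3-5) by (auto simp: p_def r_def)
  have three: "c = l1 \<or> c = l2 \<or> c = l3" for c using three_cases[of l1 l2 l3] l by auto
  have G: "state ?G"
    unfolding state_def inj_three[OF l] using l pq n_even
    by (auto simp: walk_def alternate_def)
  have "?G c s t = r \<longleftrightarrow> F c s t = r" if "t \<le> n c" for c s t
    using three[of c] F1[of t] F2[of t] F3[of t] l pq that
    by (cases s; cases "even t") (auto simp: alternate_def)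
  then have "step F ?G" unfolding step_def using F G by blast
  moreover have "conn ?G base"
    by (rule conn_base_if_transposed[OF G, of l2 l3 l1]) (use l in \<open>auto simp: alternate_def\<close>)
  ultimately show ?thesis by (rule converse_rtranclp_into_rtranclp)
qed

text \<open>\<open>f\<close> sends a ladder to the one whose \<open>True\<close> rail starts with
  the color of its \<open>False\<close> rail. As a permutation of three ladders it is the identity,
  a transposition or a 3-cycle.\<close>

lemma conn_base:
  assumes F: "state F"
  shows "conn F base"
proof -
  let ?a = "\<lambda>c. F c True 0" and ?b = "\<lambda>c. F c False 0"
  have inj: "inj ?a" "inj ?b" using F by (auto simp: state_def)
  have "surj ?a" using inj(1) by (simp add: finite_UNIV_inj_surj)
  then have ex: "\<exists>c'. ?b c = ?a c'" for c by (metis surjD)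
  define f where "f c = (SOME c'. ?b c = ?a c')" for c
  have f: "?b c = ?a (f c)" for c using someI_ex[OF ex] by (simp add: f_def)
  have "inj f" using inj(2) f by (metis injD injI)
  then have fd: "f One \<noteq> f Two" "f One \<noteq> f Three" "f Two \<noteq> f Three"
    by (auto dest: injD)
  consider (eq) "\<forall>c. f c = c"
    | (tr) l1 l2 l3 where "distinct [l1, l2, l3]" "f l1 = l2" "f l2 = l1" "f l3 = l3"
    | (cyc) l1 l2 l3 where "distinct [l1, l2, l3]" "f l1 = l2" "f l2 = l3" "f l3 = l1"
    using fd that(2)[of One Two Three] that(2)[of One Three Two] that(2)[of Two Three One]
      that(3)[of One Two Three] that(3)[of One Three Two]
    by (cases "f One"; cases "f Two"; cases "f Three") (simp_all add: all_three that(1))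
  then show ?thesis
  proof cases
    case eq
    then show ?thesis using conn_base_if_equal[OF F] f by metis
  next
    case tr
    then show ?thesis using conn_base_if_transposed[OF F tr(1)] f by metis
  next
    case cyc
    then show ?thesis using conn_base_if_cyclic[OF F cyc(1)] f by metis
  qed
qed

lemma states_connected: "state F \<Longrightarrow> state F' \<Longrightarrow> conn F F'"
  using conn_base conn_sym by (meson rtranclp_trans)

end

section \<open>The eggbeater graph\<close>

fun copy :: "three \<Rightarrow> nat" where
  "copy One = 1" | "copy Two = 2" | "copy Three = 3"

lemma copy_eq_iff [simp]: "copy c = copy d \<longleftrightarrow> c = d"
  by (cases c; cases d) auto

text \<open>Names of edges; the pendant edges of ladder \<open>c\<close> are the rail edges numbered
  \<open>0\<close> and \<open>n c\<close>.\<close>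

datatype index = Rail three bool nat | Rung three nat

context even_lengths
begin

text \<open>At positions \<open>0\<close> and \<open>Suc (n c)\<close> the value does not depend on
  the ladder, which performs the merging.\<close>

definition vertex :: "bool \<Rightarrow> three \<Rightarrow> nat \<Rightarrow> (nat \<times> ladder_vertex) + pendant" where
  "vertex s c t =
     (if t = 0 then Inr (if s then Va else Vb)
      else if t = Suc (n c) then Inr (if s then Vc else Vd)
      else Inl (copy c, if s then X t else Y t))"

text \<open>\<open>Rail c s t\<close> joins positions \<open>t\<close> and \<open>t + 1\<close>, whereas \<open>Rung c t\<close> sits at position \<open>t + 1\<close>.\<close>

fun ends :: "index \<Rightarrow> ((nat \<times> ladder_vertex) + pendant) set" where
  "ends (Rail c s t) = {vertex s c t, vertex s c (Suc t)}"
| "ends (Rung c t) = {vertex True c (Suc t), vertex False c (Suc t)}"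

fun index :: "index \<Rightarrow> bool" where
  "index (Rail c s t) \<longleftrightarrow> t \<le> n c"
| "index (Rung c t) \<longleftrightarrow> t < n c"

text \<open>Names of the edges at \<open>vertex s c t\<close>, as \<open>mem_ends_iff\<close>
  confirms; at a merged vertex each ladder contributes one.\<close>

definition star :: "bool \<Rightarrow> three \<Rightarrow> nat \<Rightarrow> index set" where
  "star s c t =
     (if t = 0 then range (\<lambda>d. Rail d s 0)
      else if t = Suc (n c) then range (\<lambda>d. Rail d s (n d))
      else {Rail c s (t - 1), Rail c s t, Rung c (t - 1)})"

abbreviation "graph \<equiv> eggbeater (n One) (n Two) (n Three)"

lemma vertex_eq_iff:
  assumes "t \<le> Suc (n c)" "u \<le> Suc (n d)"
  shows "vertex s c t = vertex s' d u \<longleftrightarrow> s = s' \<and>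
    (t = 0 \<and> u = 0 \<or> t = Suc (n c) \<and> u = Suc (n d) \<or> c = d \<and> t = u)"
  using assms n_pos[of c] n_pos[of d] by (auto simp: vertex_def)

lemma star_index: "t \<le> Suc (n c) \<Longrightarrow> a \<in> star s c t \<Longrightarrow> index a"
  by (auto simp: star_def split: if_splits)

lemma mem_ends_iff:
  assumes "index a" "t \<le> Suc (n c)"
  shows "vertex s c t \<in> ends a \<longleftrightarrow> a \<in> star s c t"
proof (cases a)
  case (Rail d s' u)
  then have "vertex s c t \<in> ends a \<longleftrightarrow> vertex s c t = vertex s' d u \<or> vertex s c t = vertex s' d (Suc u)"
    by auto
  then show ?thesis using assms n_pos[of c] n_pos[of d] Rail
    by (auto simp: vertex_eq_iff star_def)
next
  case (Rung d u)
  then have "vertex s c t \<in> ends a \<longleftrightarrow> vertex s c t = vertex True d (Suc u) \<or> vertex s c t = vertex False d (Suc u)"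
    by auto
  then show ?thesis using assms n_pos[of c] n_pos[of d] Rung
    by (cases s) (auto simp: vertex_eq_iff star_def)
qed

lemma card_star: "card (star s c t) = 3"
proof -
  have "card (range (\<lambda>d. Rail d s (f d))) = 3" for f
    by (subst card_image) (auto simp: inj_on_def UNIV_three)
  from this[of "\<lambda>_. 0"] this[of n] show ?thesis by (auto simp: star_def)
qed

lemma ends_vertex:
  assumes "index a" "v \<in> ends a"
  obtains s c t where "t \<le> Suc (n c)" "v = vertex s c t" "a \<in> star s c t"
proof -
  have "\<exists>s c t. t \<le> Suc (n c) \<and> v = vertex s c t"
  proof (cases a)
    case (Rail c s t)
    then have "v = vertex s c t \<or> v = vertex s c (Suc t)" "t \<le> Suc (n c)" "Suc t \<le> Suc (n c)"
      using assms by auto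
    then show ?thesis by blast
  next
    case (Rung c t)
    then have "v = vertex True c (Suc t) \<or> v = vertex False c (Suc t)" "Suc t \<le> Suc (n c)"
      using assms by auto
    then show ?thesis by blast
  qed
  then show ?thesis using that mem_ends_iff[OF assms(1)] assms(2) by blast
qed

text \<open>A name with the same ends as \<open>a\<close> lies in the stars of both, and these have
  only \<open>a\<close> in common.\<close>

lemma inj_on_ends: "inj_on ends (Collect index)"
proof (rule inj_onI)
  fix a b assume ab: "a \<in> Collect index" "b \<in> Collect index" "ends a = ends b"
  show "a = b"
  proof (cases a)
    case (Rail c s t)
    have "b \<in> star s c t" "b \<in> star s c (Suc t)"
      using ab Rail mem_ends_iff[of b t c s] mem_ends_iff[of b "Suc t" c s] by auto
    then show ?thesis using Rail ab n_pos[of c] by (auto simp: star_def split: if_splits)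
  next
    case (Rung c t)
    have "b \<in> star True c (Suc t)" "b \<in> star False c (Suc t)"
      using ab Rung mem_ends_iff[of b "Suc t" c True] mem_ends_iff[of b "Suc t" c False] by auto
    then show ?thesis using Rung ab n_pos[of c] by (auto simp: star_def split: if_splits)
  qed
qed

lemma edges_copy:
  "image (merge_copy (copy c)) ` edges (ladder_pendants (n c)) =
     {ends (Rail c s t) | s t. t \<le> n c} \<union> {ends (Rung c t) | t. t < n c}" (is "?L = ?R")
proof
  have rail: "ends (Rail c s t) \<in> ?R" if "t \<le> n c" for s t using that by blast
  have rung: "ends (Rung c t) \<in> ?R" if "t < n c" for t using that by blast
  show "?L \<subseteq> ?R"
  proof
    fix e assume "e \<in> ?L"
    then consider t where "1 \<le> t" "t \<le> n c" "e = {Inl (copy c, X t), Inl (copy c, Y t)}"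
      | t where "1 \<le> t" "t + 1 \<le> n c" "e = {Inl (copy c, X t), Inl (copy c, X (t + 1))}"
      | t where "1 \<le> t" "t + 1 \<le> n c" "e = {Inl (copy c, Y t), Inl (copy c, Y (t + 1))}"
      | "e = {Inr Va, Inl (copy c, X 1)}" | "e = {Inr Vb, Inl (copy c, Y 1)}"
      | "e = {Inr Vc, Inl (copy c, X (n c))}" | "e = {Inr Vd, Inl (copy c, Y (n c))}"
      by (auto simp: ladder_pendants_def ladder_def merge_copy_def)
    then show "e \<in> ?R"
    proof cases
      case 1
      then show ?thesis using rung[of "t - 1"] by (simp add: vertex_def)
    next
      case 2
      then show ?thesis using rail[of t True] by (simp add: vertex_def)
    next
      case 3
      then show ?thesis using rail[of t False] by (simp add: vertex_def)
    next
      case 4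
      then show ?thesis using rail[of 0 True] n_pos[of c] by (simp add: vertex_def)
    next
      case 5
      then show ?thesis using rail[of 0 False] n_pos[of c] by (simp add: vertex_def)
    next
      case 6
      then show ?thesis using rail[of "n c" True] n_pos[of c]
        by (simp add: vertex_def insert_commute)
    next
      case 7
      then show ?thesis using rail[of "n c" False] n_pos[of c]
        by (simp add: vertex_def insert_commute)
    qed
  qed
  let ?m = "image (merge_copy (copy c))" and ?E = "edges (ladder_pendants (n c))"
  have ladder: "Inl ` e \<in> ?E" if "e \<in> edges (ladder (n c))" for e
    using that by (simp add: ladder_pendants_def)
  have E: "{Inl (X t), Inl (Y t)} \<in> ?E" if "1 \<le> t" "t \<le> n c" for t
  proof -
    have "{X t, Y t} \<in> edges (ladder (n c))" using that unfolding ladder_def snd_conv by blast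
    from ladder[OF this] show ?thesis by simp
  qed
  have EX: "{Inl (X t), Inl (X (t + 1))} \<in> ?E" if "1 \<le> t" "t + 1 \<le> n c" for t
  proof -
    have "{X t, X (t + 1)} \<in> edges (ladder (n c))" using that unfolding ladder_def snd_conv by blast
    from ladder[OF this] show ?thesis by simp
  qed
  have EY: "{Inl (Y t), Inl (Y (t + 1))} \<in> ?E" if "1 \<le> t" "t + 1 \<le> n c" for t
  proof -
    have "{Y t, Y (t + 1)} \<in> edges (ladder (n c))" using that unfolding ladder_def snd_conv by blast
    from ladder[OF this] show ?thesis by simp
  qed
  have P: "{Inr Va, Inl (X 1)} \<in> ?E" "{Inr Vb, Inl (Y 1)} \<in> ?E"
    "{Inr Vc, Inl (X (n c))} \<in> ?E" "{Inr Vd, Inl (Y (n c))} \<in> ?E"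
    by (auto simp: ladder_pendants_def)
  show "?R \<subseteq> ?L"
  proof
    fix e assume "e \<in> ?R"
    then consider s t where "t \<le> n c" "e = ends (Rail c s t)" | t where "t < n c" "e = ends (Rung c t)"
      by blast
    then show "e \<in> ?L"
    proof cases
      case 1
      consider "t = 0" | "t = n c" | "1 \<le> t" "t + 1 \<le> n c" using 1 by linarith
      then show ?thesis
      proof cases
        case t: 1
        show ?thesis using imageI[OF P(1), of ?m] imageI[OF P(2), of ?m] 1 t n_pos[of c]
          by (cases s) (simp_all add: vertex_def merge_copy_def)
      next
        case t: 2
        show ?thesis using imageI[OF P(3), of ?m] imageI[OF P(4), of ?m] 1 t n_pos[of c]
          by (cases s) (simp_all add: vertex_def merge_copy_def insert_commute)
      next
        case t: 3
        show ?thesis using imageI[OF EX[OF t], of ?m] imageI[OF EY[OF t], of ?m] 1 t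
          by (cases s) (simp_all add: vertex_def merge_copy_def)
      qed
    next
      case 2
      then show ?thesis using imageI[OF E[of "Suc t"], of ?m]
        by (simp add: vertex_def merge_copy_def)
    qed
  qed
qed

lemma edges_graph: "edges graph = ends ` Collect index"
proof -
  have "edges graph = (\<Union>c. image (merge_copy (copy c)) ` edges (ladder_pendants (n c)))"
    by (simp add: eggbeater_def UNIV_three)
  also have "\<dots> = ends ` Collect index"
    unfolding edges_copy
  proof (intro equalityI subsetI)
    fix e assume "e \<in> ends ` Collect index"
    then obtain a where "index a" "e = ends a" by blast
    then show "e \<in> (\<Union>c. {ends (Rail c s t) |s t. t \<le> n c} \<union> {ends (Rung c t) |t. t < n c})"
      by (cases a) auto
  next
    fix e assume "e \<in> (\<Union>c. {ends (Rail c s t) |s t. t \<le> n c} \<union> {ends (Rung c t) |t. t < n c})"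
    then consider c s t where "t \<le> n c" "e = ends (Rail c s t)"
      | c t where "t < n c" "e = ends (Rung c t)" by blast
    then show "e \<in> ends ` Collect index"
    proof cases
      case (1 c s t)
      then show ?thesis by (intro image_eqI[of _ _ "Rail c s t"]) simp_all
    next
      case (2 c t)
      then show ?thesis by (intro image_eqI[of _ _ "Rung c t"]) simp_all
    qed
  qed
  finally show ?thesis .
qed

lemma finite_index: "finite (Collect index)"
proof -
  have "Collect index \<subseteq> (\<Union>c s. Rail c s ` {..n c}) \<union> (\<Union>c. Rung c ` {..<n c})"
  proof
    fix a assume "a \<in> Collect index"
    then show "a \<in> (\<Union>c s. Rail c s ` {..n c}) \<union> (\<Union>c. Rung c ` {..<n c})" by (cases a) auto
  qed
  then show ?thesis by (rule finite_subset) auto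
qed

lemma cubic_graph: "cubic graph"
  unfolding cubic_def edges_graph
proof (intro conjI ballI)
  show "finite (ends ` Collect index)" using finite_index by simp
  fix e assume "e \<in> ends ` Collect index"
  then obtain a where a: "index a" "e = ends a" by blast
  show "card e = 2"
  proof (cases a)
    case (Rail c s t)
    then have "vertex s c t \<noteq> vertex s c (Suc t)" using a by (subst vertex_eq_iff) auto
    then show ?thesis using a Rail by simp
  next
    case (Rung c t)
    then have "vertex True c (Suc t) \<noteq> vertex False c (Suc t)" using a by (subst vertex_eq_iff) auto
    then show ?thesis using a Rung by simp
  qed
next
  fix v assume "v \<in> \<Union> (ends ` Collect index)"
  then obtain a where "index a" "v \<in> ends a" by blast
  then obtain s c t where v: "t \<le> Suc (n c)" "v = vertex s c t" using ends_vertex by metis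
  have "{e \<in> ends ` Collect index. v \<in> e} = ends ` star s c t"
    using mem_ends_iff[OF _ v(1), of _ s] star_index[OF v(1), of _ s] v(2) by blast
  moreover have "inj_on ends (star s c t)"
    using inj_on_ends by (rule inj_on_subset) (use star_index[OF v(1)] in blast)
  ultimately show "card {e \<in> ends ` Collect index. v \<in> e} = 3"
    by (simp add: card_image card_star)
qed

section \<open>Correspondence between states and colorings\<close>

text \<open>In a state both rails show the same pair beside a rung, so it may be read off the
  \<open>True\<close> rail.\<close>

fun label :: "(three \<Rightarrow> bool \<Rightarrow> nat \<Rightarrow> three) \<Rightarrow> index \<Rightarrow> three" where
  "label F (Rail c s t) = F c s t"
| "label F (Rung c t) = third (F c True t) (F c True (Suc t))"

definition color_class :: "(three \<Rightarrow> bool \<Rightarrow> nat \<Rightarrow> three) \<Rightarrow> three \<Rightarrow> ((nat \<times> ladder_vertex) + pendant) set set" where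
  "color_class F x = ends ` {a. index a \<and> label F a = x}"

lemma inj_on_label_star:
  assumes F: "state F" and t: "t \<le> Suc (n c)"
  shows "inj_on (label F) (star s c t)"
proof -
  consider "t = 0" | "t = Suc (n c)" | u where "t = Suc u" "u < n c"
    using t by (cases t) (auto simp: le_less)
  then show ?thesis
  proof cases
    case 1
    then show ?thesis using F by (simp add: star_def state_def inj_on_imageI o_def)
  next
    case 2
    then show ?thesis using F by (simp add: star_def state_def inj_on_imageI o_def)
  next
    case 3
    have "F c s u \<noteq> F c s (Suc u)" using F 3 by (simp add: state_def walk_def)
    moreover have "{F c True u, F c True (Suc u)} = {F c s u, F c s (Suc u)}"
      using F 3 by (cases s) (simp_all add: state_def)
    then have "label F (Rung c u) \<noteq> F c s u" "label F (Rung c u) \<noteq> F c s (Suc u)"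
      using third_neq[of "F c True u" "F c True (Suc u)"] by (auto simp: doubleton_eq_iff)
    ultimately show ?thesis using 3 by (auto simp: star_def)
  qed
qed

lemma adjacent_label:
  assumes "state F" "index a" "index b" "v \<in> ends a" "v \<in> ends b" "label F a = label F b"
  shows "a = b"
proof -
  obtain s c t where v: "t \<le> Suc (n c)" "v = vertex s c t" "a \<in> star s c t"
    using ends_vertex[OF assms(2,4)] .
  then have "b \<in> star s c t" using mem_ends_iff[OF assms(3)] assms(5) by blast
  then show ?thesis using inj_on_label_star[OF assms(1) v(1)] v(3) assms(6) by (auto dest: inj_onD)
qed

lemma color_class_ne: "state F \<Longrightarrow> color_class F x \<noteq> {}"
proof -
  assume "state F"
  then have "surj (\<lambda>c. F c True 0)" by (simp add: state_def finite_UNIV_inj_surj)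
  then obtain c where "F c True 0 = x" by (metis surjD)
  then have "ends (Rail c True 0) \<in> color_class F x" unfolding color_class_def by (intro imageI) simp
  then show ?thesis by blast
qed

lemma color_class_disjoint: "x \<noteq> y \<Longrightarrow> color_class F x \<inter> color_class F y = {}"
  using inj_onD[OF inj_on_ends] by (auto simp: color_class_def)

lemma coloring_of_state:
  assumes F: "state F"
  shows "range (color_class F) \<in> three_edge_colorings graph"
proof -
  have "inj (color_class F)"
    using color_class_disjoint color_class_ne[OF F] by (metis Int_absorb injI)
  then have "card (range (color_class F)) = 3" by (simp add: card_image UNIV_three)
  moreover have "partition_on (edges graph) (range (color_class F))"
    unfolding partition_on_def edges_graph
  proof (intro conjI)
    show "disjoint (range (color_class F))"
      using color_class_disjoint by (intro disjointI) (metis rangeE)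
    show "{} \<notin> range (color_class F)" using color_class_ne[OF F] by (metis rangeE)
  qed (auto simp: color_class_def)
  moreover have "e \<inter> f = {}" if "e \<in> color_class F x" "f \<in> color_class F x" "e \<noteq> f" for e f x
    using that adjacent_label[OF F] unfolding color_class_def by blast
  ultimately show ?thesis unfolding three_edge_colorings_def by blast
qed

text \<open>A bijection \<open>h\<close> names the classes by colors; reading off the rails then
  gives the state.\<close>

lemma state_of_coloring:
  assumes C: "C \<in> three_edge_colorings graph"
  shows "\<exists>F. state F \<and> C = range (color_class F)"
proof -
  have union: "\<Union>C = ends ` Collect index" and disj: "disjoint C" and card: "card C = 3"
    and match: "\<And>A e f. \<lbrakk>A \<in> C; e \<in> A; f \<in> A; e \<noteq> f\<rbrakk> \<Longrightarrow> e \<inter> f = {}"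
    using C by (auto simp: three_edge_colorings_def partition_on_def edges_graph)
  have "finite C" using card by (simp add: card_ge_0_finite)
  moreover have "card (UNIV :: three set) = card C" using card by (simp add: UNIV_three)
  ultimately obtain h where h: "bij_betw h (UNIV :: three set) C"
    using finite_same_card_bij[OF finite] by blast
  then have hC: "range h = C" and hinj: "inj h" by (auto simp: bij_betw_def)
  have "\<exists>x. index a \<longrightarrow> ends a \<in> h x" for a
    using union hC by blast
  then obtain g where g: "\<And>a. index a \<Longrightarrow> ends a \<in> h (g a)" by metis
  have inj: "inj_on g (star s c t)" if t: "t \<le> Suc (n c)" for s c t
  proof (rule inj_onI)
    fix a b assume ab: "a \<in> star s c t" "b \<in> star s c t" "g a = g b"
    then have i: "index a" "index b" using star_index[OF t] by blast+
    then have "vertex s c t \<in> ends a \<inter> ends b" using ab mem_ends_iff[OF _ t] by blast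
    moreover have "h (g a) \<in> C" "ends a \<in> h (g a)" "ends b \<in> h (g a)"
      using hC g[OF i(1)] g[OF i(2)] ab(3) by auto
    ultimately have "ends a = ends b" using match[of "h (g a)" "ends a" "ends b"] by blast
    then show "a = b" using inj_on_ends i by (auto dest: inj_onD)
  qed
  define F where "F c s t = g (Rail c s t)" for c s t
  have local: "F c s t \<noteq> F c s (Suc t)" "g (Rung c t) \<noteq> F c s t" "g (Rung c t) \<noteq> F c s (Suc t)"
    if "t < n c" for c s t
    using inj[of "Suc t" c s] that by (auto simp: star_def F_def)
  \<comment> \<open>Three different colors meet at each end of a rung, so on either rail the pair is
    the complement of the rung color.\<close>
  have rung: "{F c s t, F c s (Suc t)} = - {g (Rung c t)}" if "t < n c" for c s t
    using local[OF that, of s] three_cases[of "F c s t" "F c s (Suc t)" "g (Rung c t)"] by auto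
  have F: "state F"
    unfolding state_def
  proof (intro conjI allI impI)
    show "walk (n c) (F c s)" for c s using local(1) by (simp add: walk_def)
    show "{F c True t, F c True (Suc t)} = {F c False t, F c False (Suc t)}" if "t < n c" for c t
      using rung[OF that] by simp
    \<comment> \<open>\<open>One\<close> stands for any ladder, since the star of a pendant vertex
      is common to all of them.\<close>
    show "inj (\<lambda>c. F c s 0)" for s
      using comp_inj_on[of "\<lambda>d. Rail d s 0" UNIV g] inj[of 0 One s]
      by (simp add: star_def F_def o_def inj_on_def[of "\<lambda>d. Rail d s 0"])
    show "inj (\<lambda>c. F c s (n c))" for s
      using comp_inj_on[of "\<lambda>d. Rail d s (n d)" UNIV g] inj[of "Suc (n One)" One s]
      by (simp add: star_def F_def o_def inj_on_def[of "\<lambda>d. Rail d s (n d)"])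
  qed
  have label: "label F a = g a" if "index a" for a
    using that local by (cases a) (auto simp: F_def intro!: third_eqI)
  have "color_class F x = h x" for x
  proof
    show "color_class F x \<subseteq> h x" using label g by (auto simp: color_class_def)
    show "h x \<subseteq> color_class F x"
    proof
      fix e assume e: "e \<in> h x"
      then obtain a where a: "index a" "e = ends a" using union hC by blast
      then have "e \<in> h (g a)" using g by blast
      then have "h (g a) = h x" using e disj hC by (metis disjointD disjoint_iff rangeI)
      then have "g a = x" using hinj by (auto dest: injD)
      then show "e \<in> color_class F x" using a label by (auto simp: color_class_def)
    qed
  qed
  then show ?thesis using F hC by (metis image_cong)
qed

section \<open>From steps to a single Kempe class\<close>

text \<open>A rung has color \<open>r\<close> exactly if neither rail color beside it is
  \<open>r\<close>; hence the class of \<open>r\<close> is shared and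
  \<open>shared_class_imp_kempe\<close> applies.\<close>

lemma kempe_of_step:
  assumes "step F F'"
  shows "(range (color_class F), range (color_class F')) \<in> (kempe_switch graph)\<^sup>*"
proof -
  obtain r where r: "\<And>c s t. t \<le> n c \<Longrightarrow> F c s t = r \<longleftrightarrow> F' c s t = r"
    and st: "state F" "state F'" using assms by (auto simp: step_def)
  have third_r: "third x y = r \<longleftrightarrow> x \<noteq> r \<and> y \<noteq> r" if "x \<noteq> y" for x y
    using third_neq[of x y] third_eqI[of x y r] that by auto
  have "label F a = r \<longleftrightarrow> label F' a = r" if "index a" for a
  proof (cases a)
    case (Rail c s t)
    then show ?thesis using r that by simp
  next
    case (Rung c t)
    then have "F c True t \<noteq> F c True (Suc t)" "F' c True t \<noteq> F' c True (Suc t)"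
      using st that by (auto simp: state_def walk_def)
    then show ?thesis using Rung that r[of t c True] r[of "Suc t" c True] by (simp add: third_r)
  qed
  then have "color_class F r = color_class F' r" by (auto simp: color_class_def)
  then show ?thesis
    using shared_class_imp_kempe[OF cubic_graph coloring_of_state[OF st(1)] coloring_of_state[OF st(2)]]
    by blast
qed

lemma kempe_of_conn:
  assumes "conn F F'"
  shows "(range (color_class F), range (color_class F')) \<in> (kempe_switch graph)\<^sup>*"
  using assms
proof induction
  case (step G H)
  then show ?case using kempe_of_step[of G H] by (meson rtrancl_trans)
qed simp

lemma card_kempe_classes: "card (kempe_classes graph) = 1"
proof -
  let ?T = "three_edge_colorings graph"
  have "(C, D) \<in> (kempe_switch graph)\<^sup>*" if CD: "C \<in> ?T" "D \<in> ?T" for C D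
  proof -
    obtain F H where "state F" "C = range (color_class F)" "state H" "D = range (color_class H)"
      using state_of_coloring CD by metis
    then show ?thesis using kempe_of_conn[OF states_connected] by blast
  qed
  then have "kempe_equivalence graph = ?T \<times> ?T" unfolding kempe_equivalence_def by blast
  \<comment> \<open>Some coloring must exist, or the quotient would be empty.\<close>
  moreover have "?T \<noteq> {}" using coloring_of_state[OF state_base] by blast
  ultimately have "kempe_classes graph = {?T}"
    unfolding kempe_classes_def quotient_def by auto
  then show ?thesis by simp
qed

end

theorem theorem4:
  fixes i j k :: nat
  assumes "0 < i" and "0 < j" and "0 < k"
    and "even i" and "even j" and "even k"
  shows "card (kempe_classes (eggbeater i j k)) = 1"
proof -
  \<comment> \<open>The lengths become a function of the ladder with values \<open>i\<close>,
    \<open>j\<close> and \<open>k\<close>.\<close>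
  interpret even_lengths "case_three i j k"
    by standard (use assms in \<open>auto split: three.split\<close>)
  show ?thesis using card_kempe_classes by simp
qed

end
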